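(* Let $(\mathcal{C},\lambda)$ be a $(2n+1)$-dimensional contact manifold with canonical coordinates $(x,p,z)$, $x=\{x^1,\dots,x^n\}$, $p=\{p_1,\dots,p_n\}$, $\lambda=dz-p_a\,dx^a$. Let $\psi$ be a strictly convex function of $x$ only such that the Legendre submanifold $\mathcal{A}_\psi$ generated by $\psi$ is simply connected, and let $\Phi:\mathcal{A}_\psi\to\mathcal{C}$, $x\mapsto(x,p(x),z(x))$ with $p_a(x)=\partial\psi/\partial x^a$, $z(x)=\psi(x)$, be the embedding with image $\mathcal{A}_\psi^{\mathcal{C}}$. Let $\{F^1,\dots,F^n\}$ be a set of functions of $x$ on $\mathcal{A}_\psi$ such that they do not identically vanish, and let $\check X=\dot x^a\,\partial/\partial x^a$ with $\dot x^a=F^a(x)$, $a\in\{1,\dots,n\}$, be the associated vector field on $\mathcal{A}_\psi$. Let $X^0:=\Phi_*\check X$ be its push-forward, a vector field on $\mathcal{A}_\psi^{\mathcal{C}}$. Then $$X^0=\dot x^a\frac{\partial}{\partial x^a}+\dot p_a\frac{\partial}{\partial p_a}+\dot z\frac{\partial}{\partial z},\qquad \dot x^a=F^a(x),\quad \dot p_a=\frac{d}{dt}\Big(\frac{\partial\psi}{\partial x^a}\Big),\quad \dot z=\frac{d\psi}{dt}.$$ In addition, $$X^0=X_h\big|_{h=0},$$ where $X_h$ is the contact Hamiltonian vector field on $\mathcal{C}$ associated to $$h(x,p,z)=\Delta_a(x,p)\,F^a(x)+\Gamma(\Delta_0(x,z)),$$ $\Gamma$ being a function of $\Delta_0$ such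 that $\Gamma(0)=0$ and $\Gamma(\Delta_0)\neq0$ for $\Delta_0\neq0$, and $X_h|_{h=0}$ denotes the restriction of $X_h$ to $h=0$.
   Context: All objects are smooth, repeated indices are summed over $1,\dots,n$, and everything is expressed in the canonical coordinates $(x,p,z)$. The dot and $d/dt$ denote differentiation with respect to a parameter $t$, i.e. along $\dot x^a=F^a(x)$. Put $$\Delta_0(x,z)=\psi(x)-z,\qquad \Delta_a(x,p)=\frac{\partial\psi}{\partial x^a}(x)-p_a .$$ The Legendre submanifold $\mathcal{A}_\psi$ generated by $\psi$ is parametrized by $x$ and its embedded image is $$\mathcal{A}_\psi^{\mathcal{C}}=\{(x,p,z): \Delta_0=0\ \text{and}\ \Delta_1=\dots=\Delta_n=0\}=\{p_a=\partial\psi/\partial x^a,\ z=\psi(x)\}.$$ For a function $h$ on $\mathcal{C}$, the contact Hamiltonian vector field $X_h$ is defined by $\iota_{X_h}\lambda=h$ and $\iota_{X_h}d\lambda=-(dh-(\mathcal{R}h)\lambda)$, where $\mathcal{R}=\partial/\partial z$ is the Reeb vector field; in coordinates $$\dot x^a=-\frac{\partial h}{\partial p_a},\qquad \dot p_a=\frac{\partial h}{\partial x^a}+p_a\frac{\partial h}{\partial z},\qquad \dot z=h-p_a\frac{\partial h}{\partial p_a}.$$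
   Formalization: The equality X^0 = X_h|_{h=0} is stated only at points of the image A_psi^C, together with A_psi^C being contained in {h=0}; the set {h=0} is strictly larger than A_psi^C, and X^0 is undefined off A_psi^C. *)

theory Defs
  imports "HOL-Analysis.Analysis"
begin

text \<open>
  The contact manifold is an open set of points \<open>(x, p, z)\<close>, i.e. the canonical coordinates are
  global on it. Every tangent space is identified with the type of points.
\<close>

type_synonym 'n contact_pt = "(real^'n) \<times> (real^'n) \<times> real"

fun Ck_on :: "nat \<Rightarrow> 'a::real_normed_vector set \<Rightarrow> ('a \<Rightarrow> 'b::real_normed_vector) \<Rightarrow> bool" where
  "Ck_on 0 S f \<longleftrightarrow> continuous_on S f"
| "Ck_on (Suc k) S f \<longleftrightarrow> (\<forall>x\<in>S. f differentiable (at x)) \<and>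
     (\<forall>v. Ck_on k S (\<lambda>x. frechet_derivative f (at x) v))"

definition smooth_on :: "'a::real_normed_vector set \<Rightarrow> ('a \<Rightarrow> 'b::real_normed_vector) \<Rightarrow> bool" where
  "smooth_on S f \<longleftrightarrow> (\<forall>k. Ck_on k S f)"

definition partial :: "'n::finite \<Rightarrow> (real^'n \<Rightarrow> real) \<Rightarrow> real^'n \<Rightarrow> real" where
  "partial a f x = frechet_derivative f (at x) (axis a 1)"

text \<open>
  The domain is not required to be convex: the strict inequality is demanded along every segment
  contained in it. On a convex domain this is the usual notion.
\<close>

definition strictly_convex_on :: "'a::real_vector set \<Rightarrow> ('a \<Rightarrow> real) \<Rightarrow> bool" where
  "strictly_convex_on S f \<longleftrightarrow>
     (\<forall>x y u. x \<noteq> y \<and> closed_segment x y \<subseteq> S \<and> 0 < u \<and> u < 1 \<longrightarrow>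
        f ((1 - u) *\<^sub>R x + u *\<^sub>R y) < (1 - u) * f x + u * f y)"

definition coord_x :: "'n::finite \<Rightarrow> 'n contact_pt" where "coord_x a = (axis a 1, 0, 0)"
definition coord_p :: "'n::finite \<Rightarrow> 'n contact_pt" where "coord_p a = (0, axis a 1, 0)"
definition coord_z :: "'n::finite contact_pt" where "coord_z = (0, 0, 1)"

text \<open>A 1-form \<open>\<omega>\<close> maps a point and a tangent vector to a number; \<open>\<lambda> = dz - p\<^sub>a dx\<^sup>a\<close>.\<close>

definition contact_form :: "'n::finite contact_pt \<Rightarrow> 'n contact_pt \<Rightarrow> real" where
  "contact_form = (\<lambda>(x, p, z) (vx, vp, vz). vz - (\<Sum>a\<in>UNIV. p $ a * vx $ a))"

text \<open>
  \<open>d\<omega>(u, v) = u(\<omega>(v)) - v(\<omega>(u))\<close> for constant vector fields \<open>u\<close>, \<open>v\<close>, whose bracket vanishes.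
\<close>

definition ext_deriv :: "('a::real_normed_vector \<Rightarrow> 'a \<Rightarrow> real) \<Rightarrow> 'a \<Rightarrow> 'a \<Rightarrow> 'a \<Rightarrow> real" where
  "ext_deriv \<omega> y u v =
     frechet_derivative (\<lambda>y'. \<omega> y' v) (at y) u - frechet_derivative (\<lambda>y'. \<omega> y' u) (at y) v"

text \<open>
  \<open>\<iota>\<^sub>X \<lambda> = h\<close> and \<open>\<iota>\<^sub>X d\<lambda> = -(dh - (\<R>h) \<lambda>)\<close>, where \<open>\<R> = \<partial>/\<partial>z\<close> is the Reeb vector field.
\<close>

definition contact_ham_vf ::
  "('n::finite contact_pt \<Rightarrow> real) \<Rightarrow> 'n contact_pt \<Rightarrow> 'n contact_pt" where
  "contact_ham_vf h y = (THE X.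
     contact_form y X = h y \<and>
     (\<forall>v. ext_deriv contact_form y X v =
        - (frechet_derivative h (at y) v
           - frechet_derivative h (at y) coord_z * contact_form y v)))"

definition Delta0 :: "(real^'n \<Rightarrow> real) \<Rightarrow> 'n::finite contact_pt \<Rightarrow> real" where
  "Delta0 \<psi> = (\<lambda>(x, p, z). \<psi> x - z)"

definition Delta :: "(real^'n \<Rightarrow> real) \<Rightarrow> 'n \<Rightarrow> 'n::finite contact_pt \<Rightarrow> real" where
  "Delta \<psi> a = (\<lambda>(x, p, z). partial a \<psi> x - p $ a)"

definition legendre_emb :: "(real^'n \<Rightarrow> real) \<Rightarrow> real^'n \<Rightarrow> 'n::finite contact_pt" where
  "legendre_emb \<psi> x = (x, (\<chi> a. partial a \<psi> x), \<psi> x)"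

definition legendre_submanifold ::
  "'n::finite contact_pt set \<Rightarrow> (real^'n \<Rightarrow> real) \<Rightarrow> 'n contact_pt set" where
  "legendre_submanifold C \<psi> = {y \<in> C. Delta0 \<psi> y = 0 \<and> (\<forall>a. Delta \<psi> a y = 0)}"

text \<open>Push-forward of a vector field \<open>V\<close> on \<open>U\<close> along a map \<open>\<phi>\<close> injective on \<open>U\<close>.\<close>

definition pushforward ::
  "'a::real_normed_vector set \<Rightarrow> ('a \<Rightarrow> 'b::real_normed_vector) \<Rightarrow> ('a \<Rightarrow> 'a) \<Rightarrow> 'b \<Rightarrow> 'b" where
  "pushforward U \<phi> V y =
     (let x = the_inv_into U \<phi> y in frechet_derivative \<phi> (at x) (V x))"

definition ham ::
  "(real^'n \<Rightarrow> real) \<Rightarrow> (real^'n \<Rightarrow> real^'n) \<Rightarrow> (real \<Rightarrow> real) \<Rightarrow> 'n::finite contact_pt \<Rightarrow> real" where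
  "ham \<psi> F \<Gamma> y = (\<Sum>a\<in>UNIV. Delta \<psi> a y * F (fst y) $ a) + \<Gamma> (Delta0 \<psi> y)"

lemma ext_deriv_contact_form:
  fixes y :: "'n::finite contact_pt"
  shows "ext_deriv contact_form y (ux, up, uz) (vx, vp, vz) =
     (\<Sum>a\<in>UNIV. ux $ a * vp $ a) - (\<Sum>a\<in>UNIV. up $ a * vx $ a)"
proof -
  have "frechet_derivative (\<lambda>y'. contact_form y' (wx, wp, wz)) (at y)
      = (\<lambda>(tx, tp, tz). - (\<Sum>a\<in>UNIV. tp $ a * wx $ a))" for wx wp :: "real^'n" and wz :: real
  proof (rule frechet_derivative_at[symmetric])
    have "((\<lambda>y'. wz - fst (snd y') \<bullet> wx) has_derivative (\<lambda>t. - (fst (snd t) \<bullet> wx))) (at y)"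
      by (auto intro!: derivative_eq_intros)
    then show "((\<lambda>y'. contact_form y' (wx, wp, wz)) has_derivative
        (\<lambda>(tx, tp, tz). - (\<Sum>a\<in>UNIV. tp $ a * wx $ a))) (at y)"
      by (simp add: contact_form_def inner_vec_def case_prod_unfold)
  qed
  then show ?thesis by (simp add: ext_deriv_def mult.commute)
qed

text \<open>The definition agrees with the coordinate expression of the contact Hamiltonian flow.\<close>

lemma contact_ham_vf_coords:
  fixes h :: "'n::finite contact_pt \<Rightarrow> real"
  assumes "h differentiable (at (x, p, z))"
  defines "D \<equiv> frechet_derivative h (at (x, p, z))"
  shows "contact_ham_vf h (x, p, z) =
    (\<chi> a. - D (coord_p a), \<chi> a. D (coord_x a) + p $ a * D coord_z,
     h (x, p, z) - (\<Sum>a\<in>UNIV. p $ a * D (coord_p a)))"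
proof -
  have lin: "linear D"
    unfolding D_def using assms(1) linear_frechet_derivative by blast
  have exp: "D (vx, vp, vz) = (\<Sum>a\<in>UNIV. vx $ a * D (coord_x a)) +
      (\<Sum>a\<in>UNIV. vp $ a * D (coord_p a)) + vz * D coord_z" for vx vp :: "real^'n" and vz :: real
  proof -
    have ax: "(\<Sum>a\<in>UNIV. v $ a *\<^sub>R axis a 1) = v" for v :: "real^'n"
      using basis_expansion[of v] by (simp add: scalar_mult_eq_scaleR)
    have "(vx, vp, vz) = (\<Sum>a\<in>UNIV. vx $ a *\<^sub>R coord_x a) +
        (\<Sum>a\<in>UNIV. vp $ a *\<^sub>R coord_p a) + vz *\<^sub>R coord_z"
      by (simp add: prod_eq_iff fst_sum snd_sum coord_x_def coord_p_def coord_z_def ax)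
    then show ?thesis
      by (simp add: linear_add[OF lin] linear_sum[OF lin] linear_scale[OF lin])
  qed
  show ?thesis
    unfolding contact_ham_vf_def D_def[symmetric]
  proof (rule the_equality, goal_cases)
    case 1
    have "ext_deriv contact_form (x, p, z)
        (\<chi> a. - D (coord_p a), \<chi> a. D (coord_x a) + p $ a * D coord_z, s) (vx, vp, vz) =
        - (D (vx, vp, vz) - D coord_z * contact_form (x, p, z) (vx, vp, vz))" for s vx vp vz
      unfolding ext_deriv_contact_form
      by (simp add: exp contact_form_def sum_negf sum_distrib_left
          sum_distrib_right sum.distrib algebra_simps)
    then show ?case
      by (auto simp: contact_form_def sum_negf)
  next
    case (2 X)
    obtain X1 X2 X3 where X: "X = (X1, X2, X3)" by (cases X) auto
    have A: "ext_deriv contact_form (x, p, z) (X1, X2, X3) v =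
        - (D v - D coord_z * contact_form (x, p, z) v)" for v
      using 2 X by blast
    have ax: "(\<Sum>b\<in>UNIV. v $ b * axis a 1 $ b) = v $ a" for v :: "real^'n" and a
      using inner_axis[of v a 1] by (simp add: inner_vec_def)
    have X1: "X1 $ a = - D (coord_p a)" for a
      using A[of "coord_p a"] unfolding coord_p_def ext_deriv_contact_form
      by (simp add: contact_form_def ax)
    have X2: "X2 $ a = D (coord_x a) + p $ a * D coord_z" for a
      using A[of "coord_x a"] unfolding coord_x_def ext_deriv_contact_form
      by (simp add: contact_form_def ax mult.commute)
    show ?case
      using 2 by (auto simp: X vec_eq_iff X1 X2 contact_form_def sum_negf)
  qed
qed

end

theory Submission
  imports Defs
begin

text \<open>
  On the Legendre submanifold \<open>\<Delta>\<^sub>0\<close> and all \<open>\<Delta>\<^sub>a\<close> vanish, so only the derivatives of the factors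
  \<open>\<Delta>\<^sub>a\<close> and \<open>\<Gamma> \<circ> \<Delta>\<^sub>0\<close> contribute to \<open>dh\<close>. The two terms in \<open>\<Gamma>'(0)\<close> cancel in
  \<open>\<partial>h/\<partial>x\<^sup>a + p\<^sub>a \<partial>h/\<partial>z\<close>, which leaves \<open>F\<^sup>b \<partial>\<^sub>a\<partial>\<^sub>b\<psi>\<close>; this is the component \<open>F\<^sup>b \<partial>\<^sub>b\<partial>\<^sub>a\<psi>\<close> of the
  push-forward by the symmetry of second derivatives.
\<close>

section \<open>Smooth functions and their derivatives\<close>

lemma smooth_on_subset:
  assumes "smooth_on S f" "T \<subseteq> S"
  shows "smooth_on T f"
proof -
  \<comment> \<open>The derivatives in \<open>Ck_on\<close> are taken at a point of the whole space,
    not within the set, so they do not change when the set shrinks.\<close>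
  have "Ck_on k S f \<Longrightarrow> Ck_on k T f" for k
    using assms(2) by (induction k arbitrary: f) (auto intro: continuous_on_subset)
  then show ?thesis
    using assms(1) unfolding smooth_on_def by blast
qed

lemma smooth_on_differentiable:
  assumes "smooth_on S f" "x \<in> S"
  shows "f differentiable (at x)"
  using assms Ck_on.simps(2)[of 0 S f] unfolding smooth_on_def by blast

lemma smooth_on_continuous_on:
  assumes "smooth_on S f"
  shows "continuous_on S f"
  using assms Ck_on.simps(1)[of S f] unfolding smooth_on_def by blast

lemma smooth_on_frechet_derivative:
  assumes "smooth_on S f"
  shows "smooth_on S (\<lambda>x. frechet_derivative f (at x) v)"
  using assms Ck_on.simps(2)[of _ S f] unfolding smooth_on_def by blast

lemma smooth_on_has_derivative:
  assumes "smooth_on S f" "x \<in> S"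
  shows "(f has_derivative frechet_derivative f (at x)) (at x)"
  using smooth_on_differentiable[OF assms] frechet_derivative_works by blast

lemma smooth_on_partial:
  assumes "smooth_on S f"
  shows "smooth_on S (partial a f)"
  using smooth_on_frechet_derivative[OF assms] unfolding partial_def[abs_def] .

section \<open>Symmetry of second derivatives\<close>

lemma has_real_derivative_along_line:
  fixes f :: "'a::real_normed_vector \<Rightarrow> real"
  assumes "f differentiable (at (y + s *\<^sub>R u))"
  shows "((\<lambda>s. f (y + s *\<^sub>R u)) has_real_derivative frechet_derivative f (at (y + s *\<^sub>R u)) u) (at s)"
proof -
  let ?D = "frechet_derivative f (at (y + s *\<^sub>R u))"
  have D: "(f has_derivative ?D) (at (y + s *\<^sub>R u))"
    using assms frechet_derivative_works by blast
  have "((\<lambda>s. y + s *\<^sub>R u) has_derivative (\<lambda>h. h *\<^sub>R u)) (at s)"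
    by (auto intro!: derivative_eq_intros)
  then have "((\<lambda>s. f (y + s *\<^sub>R u)) has_derivative (\<lambda>h. ?D (h *\<^sub>R u))) (at s)"
    using D by (rule has_derivative_compose)
  moreover have "?D (h *\<^sub>R u) = ?D u * h" for h
    using linear_scale[OF has_derivative_linear[OF D]] by simp
  ultimately show ?thesis
    by (simp add: has_field_derivative_def)
qed

text \<open>Two uses of the mean value theorem, the first in direction \<open>u\<close>, the second
  in direction \<open>v\<close> on the derivative along \<open>u\<close>. The bound on
  \<open>r\<close> keeps the whole parallelogram spanned by \<open>r *\<^sub>R u\<close> and
  \<open>r *\<^sub>R v\<close> inside the ball.\<close>

lemma second_difference_mean_value:
  fixes f :: "'a::real_normed_vector \<Rightarrow> real"
  assumes f: "smooth_on (ball x e) f" and r: "0 < r" "r * (norm u + norm v) < e"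
  obtains \<sigma> \<tau> where "0 < \<sigma>" "\<sigma> < r" "0 < \<tau>" "\<tau> < r"
    "f (x + r *\<^sub>R u + r *\<^sub>R v) - f (x + r *\<^sub>R u) - f (x + r *\<^sub>R v) + f x =
      r * r * frechet_derivative (\<lambda>y. frechet_derivative f (at y) u) (at (x + \<sigma> *\<^sub>R u + \<tau> *\<^sub>R v)) v"
proof -
  define g where "g y = frechet_derivative f (at y) u" for y
  have in_ball: "x + s *\<^sub>R u + t *\<^sub>R v \<in> ball x e" if "0 \<le> s" "s \<le> r" "0 \<le> t" "t \<le> r" for s t
  proof -
    have "norm (s *\<^sub>R u + t *\<^sub>R v) \<le> s * norm u + t * norm v"
      using norm_triangle_ineq[of "s *\<^sub>R u" "t *\<^sub>R v"] that by simp
    also have "\<dots> \<le> r * norm u + r * norm v"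
      using that by (intro add_mono mult_right_mono) auto
    finally show ?thesis
      using r(2) norm_minus_cancel[of "s *\<^sub>R u + t *\<^sub>R v"]
      by (simp add: dist_norm distrib_left)
  qed
  have df: "((\<lambda>s. f (x + s *\<^sub>R u + t *\<^sub>R v)) has_real_derivative g (x + s *\<^sub>R u + t *\<^sub>R v)) (at s)"
    if "0 \<le> s" "s \<le> r" "0 \<le> t" "t \<le> r" for s t
    using has_real_derivative_along_line[of f "x + t *\<^sub>R v" s u]
      smooth_on_differentiable[OF f in_ball[OF that]]
    by (simp add: g_def add.commute add.left_commute)
  \<comment> \<open>Mean value theorem on the interval from 0 to \<open>r\<close> for the difference
    of \<open>f\<close> along the two sides parallel to \<open>u\<close>. The idle zeros give all
    four corners the form covered by \<open>df\<close>.\<close>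
  have "\<exists>\<sigma>. 0 < \<sigma> \<and> \<sigma> < r \<and>
      (f (x + r *\<^sub>R u + r *\<^sub>R v) - f (x + r *\<^sub>R u + 0 *\<^sub>R v))
        - (f (x + 0 *\<^sub>R u + r *\<^sub>R v) - f (x + 0 *\<^sub>R u + 0 *\<^sub>R v)) =
      (r - 0) * (g (x + \<sigma> *\<^sub>R u + r *\<^sub>R v) - g (x + \<sigma> *\<^sub>R u + 0 *\<^sub>R v))"
    using r(1) by (intro MVT2 DERIV_diff df) auto
  then obtain \<sigma> where \<sigma>: "0 < \<sigma>" "\<sigma> < r" and eq1:
    "f (x + r *\<^sub>R u + r *\<^sub>R v) - f (x + r *\<^sub>R u) - f (x + r *\<^sub>R v) + f x =
      r * (g (x + \<sigma> *\<^sub>R u + r *\<^sub>R v) - g (x + \<sigma> *\<^sub>R u))"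
    by auto
  have g: "smooth_on (ball x e) g"
    using smooth_on_frechet_derivative[OF f] by (simp add: g_def[abs_def])
  \<comment> \<open>Now \<sigma> is fixed and the point moves in direction \<open>v\<close>.\<close>
  have "\<exists>\<tau>. 0 < \<tau> \<and> \<tau> < r \<and>
      g (x + \<sigma> *\<^sub>R u + r *\<^sub>R v) - g (x + \<sigma> *\<^sub>R u + 0 *\<^sub>R v) =
      (r - 0) * frechet_derivative g (at (x + \<sigma> *\<^sub>R u + \<tau> *\<^sub>R v)) v"
    using r(1) \<sigma>
    by (intro MVT2 has_real_derivative_along_line smooth_on_differentiable[OF g] in_ball) auto
  then obtain \<tau> where \<tau>: "0 < \<tau>" "\<tau> < r" and eq2: "g (x + \<sigma> *\<^sub>R u + r *\<^sub>R v) - g (x + \<sigma> *\<^sub>R u) =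
      r * frechet_derivative g (at (x + \<sigma> *\<^sub>R u + \<tau> *\<^sub>R v)) v"
    by auto
  show ?thesis
    by (rule that[OF \<sigma> \<tau>]) (use eq1 eq2 in \<open>simp add: g_def[abs_def]\<close>)
qed

text \<open>By the mean value form the quotient equals the iterated derivative at a nearby point,
  which tends to \<open>x\<close> with \<open>r\<close>; continuity of that derivative gives the
  limit.\<close>

lemma second_difference_quotient_tendsto:
  fixes f :: "'a::real_normed_vector \<Rightarrow> real"
  assumes f: "smooth_on S f" and S: "open S" "x \<in> S"
  shows "((\<lambda>r. (f (x + r *\<^sub>R u + r *\<^sub>R v) - f (x + r *\<^sub>R u) - f (x + r *\<^sub>R v) + f x) / (r * r))
    \<longlongrightarrow> frechet_derivative (\<lambda>y. frechet_derivative f (at y) u) (at x) v) (at_right 0)"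
proof -
  define G where "G y = frechet_derivative (\<lambda>y. frechet_derivative f (at y) u) (at y) v" for y
  obtain e where e: "0 < e" "ball x e \<subseteq> S"
    using S open_contains_ball by blast
  have "smooth_on S G"
    unfolding G_def[abs_def] by (intro smooth_on_frechet_derivative f)
  then have "isCont G x"
    using smooth_on_continuous_on S continuous_on_eq_continuous_at by blast
  have "\<forall>\<^sub>F r in at_right 0.
      dist ((f (x + r *\<^sub>R u + r *\<^sub>R v) - f (x + r *\<^sub>R u) - f (x + r *\<^sub>R v) + f x) / (r * r)) (G x) < \<epsilon>"
    if "0 < \<epsilon>" for \<epsilon>
  proof -
    obtain d where d: "0 < d" "\<And>y. dist y x < d \<Longrightarrow> dist (G y) (G x) < \<epsilon>"
      using \<open>isCont G x\<close> \<open>0 < \<epsilon>\<close> unfolding continuous_at_eps_delta by metis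
    have "((\<lambda>r. r * (norm u + norm v)) \<longlongrightarrow> 0 * (norm u + norm v)) (at_right 0)"
      by (intro tendsto_intros)
    \<comment> \<open>The bound by \<open>e\<close> makes the mean value form available in the ball;
      the bound by \<open>d\<close> puts the intermediate point where \<open>G\<close> is
      \<epsilon>-close to \<open>G x\<close>.\<close>
    then have "\<forall>\<^sub>F r in at_right 0. r * (norm u + norm v) < min d e"
      using d(1) e(1) by (intro order_tendstoD(2)) auto
    moreover have "\<forall>\<^sub>F r::real in at_right 0. 0 < r"
      by (rule eventually_at_right_less)
    ultimately show ?thesis
    proof eventually_elim
      case (elim r)
      obtain \<sigma> \<tau> where *: "0 < \<sigma>" "\<sigma> < r" "0 < \<tau>" "\<tau> < r"
        "f (x + r *\<^sub>R u + r *\<^sub>R v) - f (x + r *\<^sub>R u) - f (x + r *\<^sub>R v) + f x =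
          r * r * G (x + \<sigma> *\<^sub>R u + \<tau> *\<^sub>R v)"
        using second_difference_mean_value[of x e f r u v] smooth_on_subset[OF f e(2)] elim
        unfolding G_def by auto
      have "norm (\<sigma> *\<^sub>R u + \<tau> *\<^sub>R v) \<le> \<sigma> * norm u + \<tau> * norm v"
        using norm_triangle_ineq[of "\<sigma> *\<^sub>R u" "\<tau> *\<^sub>R v"] * by simp
      also have "\<dots> \<le> r * norm u + r * norm v"
        using * by (intro add_mono mult_right_mono) auto
      finally have "dist (x + \<sigma> *\<^sub>R u + \<tau> *\<^sub>R v) x < d"
        using elim by (simp add: dist_norm distrib_left add.assoc)
      then show ?case
        using d(2) *(5) elim by simp
    qed
  qed
  then show ?thesis
    unfolding G_def by (rule tendstoI)
qed

text \<open>The second difference is unchanged when \<open>u\<close> and \<open>v\<close> are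
  exchanged, so both iterated derivatives are limits of the same quotient.\<close>

lemma second_derivative_symmetric:
  fixes f :: "'a::real_normed_vector \<Rightarrow> real"
  assumes "smooth_on S f" "open S" "x \<in> S"
  shows "frechet_derivative (\<lambda>y. frechet_derivative f (at y) u) (at x) v =
    frechet_derivative (\<lambda>y. frechet_derivative f (at y) v) (at x) u"
  using second_difference_quotient_tendsto[OF assms, of u v]
    second_difference_quotient_tendsto[OF assms, of v u]
  by (intro tendsto_unique[OF trivial_limit_at_right_real[of "0::real"]])
     (simp_all add: algebra_simps)

section \<open>Expansions in the standard basis\<close>

lemma sum_scaleR_axis:
  fixes c :: "'n::finite \<Rightarrow> real"
  shows "(\<Sum>a\<in>UNIV. c a *\<^sub>R axis a 1) = (\<chi> a. c a)"
  using basis_expansion[of "\<chi> a. c a"] by (simp add: scalar_mult_eq_scaleR)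

lemma linear_sum_axis:
  fixes L :: "real^'n \<Rightarrow> real"
  assumes "linear L"
  shows "L v = (\<Sum>a\<in>UNIV. v $ a * L (axis a 1))"
proof -
  have "L v = L (\<Sum>a\<in>UNIV. v $ a *\<^sub>R axis a 1)"
    by (simp add: sum_scaleR_axis)
  then show ?thesis
    by (simp add: linear_sum[OF assms] linear_scale[OF assms])
qed

text \<open>Symmetry swaps the two partial derivatives, and linearity collects the sum into one
  directional derivative. With \<open>v\<close> equal to \<open>F x\<close> this matches the
  \<psi>-term of \<open>dh\<close> with the \<open>p\<close>-component of the push-forward.\<close>

lemma sum_partial_partial:
  assumes "smooth_on S f" "open S" "x \<in> S"
  shows "(\<Sum>b\<in>UNIV. v $ b * partial a (partial b f) x) =
    frechet_derivative (partial a f) (at x) v"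
proof -
  have "partial a (partial b f) x = partial b (partial a f) x" for b
    using second_derivative_symmetric[OF assms] unfolding partial_def[abs_def] .
  then show ?thesis
    using linear_sum_axis[OF has_derivative_linear[OF
        smooth_on_has_derivative[OF smooth_on_partial[OF assms(1)] assms(3)]], of a v]
    by (simp add: partial_def[of _ "partial a f"])
qed

section \<open>The Legendre embedding and its push-forward\<close>

lemma inj_on_legendre_emb: "inj_on (legendre_emb \<psi>) U"
  by (rule inj_onI) (simp add: legendre_emb_def)

lemma legendre_submanifold_eq_emb:
  assumes "y \<in> legendre_submanifold C \<psi>"
  shows "y = legendre_emb \<psi> (fst y)"
  using assms
  by (cases y) (auto simp: legendre_submanifold_def legendre_emb_def Delta0_def Delta_def vec_eq_iff)

text \<open>A vector is the finite sum of its entries times basis vectors, so the rules for sums and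
  scalar multiples suffice.\<close>

lemma has_derivative_vec_lambda:
  fixes f :: "'a::real_normed_vector \<Rightarrow> 'n::finite \<Rightarrow> real"
  assumes "\<And>a. ((\<lambda>x. f x a) has_derivative f' a) F"
  shows "((\<lambda>x. \<chi> a. f x a) has_derivative (\<lambda>v. \<chi> a. f' a v)) F"
proof -
  have "((\<lambda>x. \<Sum>a\<in>UNIV. f x a *\<^sub>R axis a 1) has_derivative
      (\<lambda>v. \<Sum>a\<in>UNIV. f' a v *\<^sub>R (axis a 1 :: real^'n))) F"
    by (intro has_derivative_sum has_derivative_scaleR_left assms)
  then show ?thesis by (simp add: sum_scaleR_axis)
qed

lemma has_derivative_legendre_emb:
  assumes "smooth_on U \<psi>" "x \<in> U"
  shows "(legendre_emb \<psi> has_derivative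
    (\<lambda>v. (v, \<chi> a. frechet_derivative (partial a \<psi>) (at x) v, frechet_derivative \<psi> (at x) v))) (at x)"
  unfolding legendre_emb_def[abs_def]
  by (intro has_derivative_Pair has_derivative_ident has_derivative_vec_lambda
      smooth_on_has_derivative[OF _ assms(2)] smooth_on_partial assms(1))

text \<open>By injectivity the inverse in \<open>pushforward\<close> returns \<open>x\<close>, and
  the derivative of the embedding is then applied to \<open>F x\<close>.\<close>

lemma pushforward_legendre_emb:
  assumes "smooth_on U \<psi>" "x \<in> U"
  shows "pushforward U (legendre_emb \<psi>) F (legendre_emb \<psi> x) =
    (F x, \<chi> a. frechet_derivative (partial a \<psi>) (at x) (F x), frechet_derivative \<psi> (at x) (F x))"
  using frechet_derivative_at[OF has_derivative_legendre_emb[OF assms], symmetric]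
  by (simp add: pushforward_def the_inv_into_f_f[OF inj_on_legendre_emb assms(2)])

section \<open>The contact Hamiltonian on the Legendre submanifold\<close>

lemma ham_legendre_emb: "\<Gamma> 0 = 0 \<Longrightarrow> ham \<psi> F \<Gamma> (legendre_emb \<psi> x) = 0"
  by (simp add: ham_def legendre_emb_def Delta_def Delta0_def)

text \<open>In the product rule every derivative of \<open>F\<close> is multiplied by some
  \<open>Delta \<psi> a\<close>, which vanishes at the embedded point. The constant \<open>c\<close>
  is the derivative of \<Gamma> at 0, the value of \<open>Delta0 \<psi>\<close> there.\<close>

lemma has_derivative_ham:
  fixes \<psi> :: "real^'n \<Rightarrow> real"
  assumes \<psi>: "smooth_on U \<psi>" and F: "smooth_on U F" and x: "x \<in> U"
    and \<Gamma>: "(\<Gamma> has_real_derivative c) (at 0)"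
  shows "(ham \<psi> F \<Gamma> has_derivative
    (\<lambda>(vx, vp, vz). (\<Sum>a\<in>UNIV. (frechet_derivative (partial a \<psi>) (at x) vx - vp $ a) * F x $ a)
      + c * (frechet_derivative \<psi> (at x) vx - vz))) (at (legendre_emb \<psi> x))"
proof -
  let ?y = "legendre_emb \<psi> x"
  have fst: "fst ?y = x" by (simp add: legendre_emb_def)
  have comp: "((\<lambda>y. f (fst y)) has_derivative (\<lambda>v. frechet_derivative f (at x) (fst v))) (at ?y)"
    if "smooth_on U f" for f :: "real^'n \<Rightarrow> 'c::real_normed_vector"
    using has_derivative_compose[OF has_derivative_fst[OF has_derivative_ident], of f _ ?y UNIV]
      smooth_on_has_derivative[OF that x]
    by (simp add: fst)
  have nth: "((\<lambda>y. g y $ a) has_derivative (\<lambda>v. g' v $ a)) (at ?y)"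
    if "(g has_derivative g') (at ?y)" for g :: "'n contact_pt \<Rightarrow> real^'n" and g' a
    using bounded_linear.has_derivative[OF bounded_linear_vec_nth that] .
  have Delta: "(Delta \<psi> a has_derivative
      (\<lambda>v. frechet_derivative (partial a \<psi>) (at x) (fst v) - fst (snd v) $ a)) (at ?y)" for a
    unfolding Delta_def case_prod_unfold
    by (intro has_derivative_diff comp smooth_on_partial \<psi> nth has_derivative_fst
        has_derivative_snd has_derivative_ident)
  have "(Delta0 \<psi> has_derivative (\<lambda>v. frechet_derivative \<psi> (at x) (fst v) - snd (snd v))) (at ?y)"
    unfolding Delta0_def case_prod_unfold
    by (intro has_derivative_diff comp \<psi> has_derivative_snd has_derivative_ident)
  moreover have "(\<Gamma> has_derivative (*) c) (at (Delta0 \<psi> ?y))"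
    using \<Gamma> by (simp add: has_field_derivative_def Delta0_def legendre_emb_def)
  ultimately have "((\<lambda>y. \<Gamma> (Delta0 \<psi> y)) has_derivative
      (\<lambda>v. c * (frechet_derivative \<psi> (at x) (fst v) - snd (snd v)))) (at ?y)"
    by (rule has_derivative_compose)
  moreover have "((\<lambda>y. \<Sum>a\<in>UNIV. Delta \<psi> a y * F (fst y) $ a) has_derivative
      (\<lambda>v. \<Sum>a\<in>UNIV. Delta \<psi> a ?y * frechet_derivative F (at x) (fst v) $ a +
        (frechet_derivative (partial a \<psi>) (at x) (fst v) - fst (snd v) $ a) * F (fst ?y) $ a)) (at ?y)"
    by (intro has_derivative_sum has_derivative_mult Delta nth comp F)
  \<comment> \<open>This removes the terms containing the derivative of \<open>F\<close>.\<close>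
  moreover have "Delta \<psi> a ?y = 0" for a
    by (simp add: Delta_def legendre_emb_def)
  ultimately show ?thesis
    unfolding ham_def[abs_def] case_prod_unfold
    by (auto simp: fst dest: has_derivative_add)
qed

lemma contact_ham_vf_ham:
  fixes \<psi> :: "real^'n \<Rightarrow> real"
  assumes \<psi>: "smooth_on U \<psi>" and F: "smooth_on U F" and U: "open U" "x \<in> U"
    and \<Gamma>: "\<Gamma> differentiable (at 0)" "\<Gamma> 0 = 0"
  shows "contact_ham_vf (ham \<psi> F \<Gamma>) (legendre_emb \<psi> x) =
    (F x, \<chi> a. frechet_derivative (partial a \<psi>) (at x) (F x), frechet_derivative \<psi> (at x) (F x))"
proof -
  obtain c where "(\<Gamma> has_real_derivative c) (at 0)"
    using \<Gamma>(1) real_differentiable_def by blast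
  note der = has_derivative_ham[OF \<psi> F U(2) this]
  have D: "frechet_derivative (ham \<psi> F \<Gamma>) (at (legendre_emb \<psi> x)) =
    (\<lambda>(vx, vp, vz). (\<Sum>a\<in>UNIV. (frechet_derivative (partial a \<psi>) (at x) vx - vp $ a) * F x $ a)
      + c * (frechet_derivative \<psi> (at x) vx - vz))"
    using frechet_derivative_at[OF der] by simp
  have zero: "frechet_derivative f (at x) 0 = 0" if "smooth_on U f" for f :: "real^'n \<Rightarrow> real"
    using linear_0[OF has_derivative_linear[OF smooth_on_has_derivative[OF that U(2)]]] .
  note zeros = zero[OF \<psi>] zero[OF smooth_on_partial[OF \<psi>]]
  \<comment> \<open>The term with \<open>c\<close> cancels in the \<open>p\<close>-component: there
    \<open>Dz\<close> contributes \<open>- c\<close> times the momentum, which is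
    \<open>partial a \<psi> x\<close> on the submanifold.\<close>
  have Dx: "frechet_derivative (ham \<psi> F \<Gamma>) (at (legendre_emb \<psi> x)) (coord_x a) =
      frechet_derivative (partial a \<psi>) (at x) (F x) + c * partial a \<psi> x" for a
    using sum_partial_partial[OF \<psi> U, of "F x" a]
    by (simp add: D coord_x_def partial_def[of a] mult.commute)
  have Dp: "frechet_derivative (ham \<psi> F \<Gamma>) (at (legendre_emb \<psi> x)) (coord_p a) = - F x $ a" for a
    using inner_axis[of "F x" a 1]
    by (simp add: D coord_p_def zeros inner_vec_def sum_negf mult.commute)
  have Dz: "frechet_derivative (ham \<psi> F \<Gamma>) (at (legendre_emb \<psi> x)) coord_z = - c"
    by (simp add: D coord_z_def zeros)
  \<comment> \<open>This is the \<open>z\<close>-component: \<open>h\<close> is zero at the point,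
    and by \<open>Dp\<close> the remaining term is the momentum paired with
    \<open>F x\<close>.\<close>
  have "(\<Sum>a\<in>UNIV. partial a \<psi> x * F x $ a) = frechet_derivative \<psi> (at x) (F x)"
    using linear_sum_axis[OF has_derivative_linear[OF smooth_on_has_derivative[OF \<psi> U(2)]], of "F x"]
    by (simp add: partial_def mult.commute)
  moreover have "ham \<psi> F \<Gamma> differentiable (at (legendre_emb \<psi> x))"
    using der differentiable_def by blast
  ultimately show ?thesis
    using contact_ham_vf_coords[of "ham \<psi> F \<Gamma>" x "\<chi> a. partial a \<psi> x" "\<psi> x"]
      ham_legendre_emb[of \<Gamma> \<psi> F x] \<Gamma>(2) Dx Dp Dz
    by (simp add: legendre_emb_def vec_eq_iff sum_negf)
qed

section \<open>Derivatives along curves and the comparison of the two vector fields\<close>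

lemma has_real_derivative_along_curve:
  fixes f :: "'a::real_normed_vector \<Rightarrow> real"
  assumes "smooth_on U f" "\<gamma> t \<in> U" "(\<gamma> has_vector_derivative w) (at t)"
  shows "((\<lambda>s. f (\<gamma> s)) has_real_derivative frechet_derivative f (at (\<gamma> t)) w) (at t)"
  using vector_derivative_diff_chain_within[of \<gamma> w t UNIV f "frechet_derivative f (at (\<gamma> t))"]
    has_derivative_at_withinI[OF smooth_on_has_derivative[OF assms(1,2)]] assms(3)
  by (simp add: has_real_derivative_iff_has_vector_derivative o_def)

lemma sum_coords:
  "(\<Sum>a\<in>UNIV. vx $ a *\<^sub>R coord_x a) + (\<Sum>a\<in>UNIV. vp a *\<^sub>R coord_p a) + vz *\<^sub>R coord_z =
    (vx, \<chi> a. vp a, vz)"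
  by (simp add: prod_eq_iff fst_sum snd_sum coord_x_def coord_p_def coord_z_def)
     (simp only: sum_scaleR_axis vec_nth_inverse)

text \<open>The dot is encoded through arbitrary curves with velocity \<open>F (\<gamma> t)\<close>
  at time \<open>t\<close>. The restriction of the Hamiltonian field to \<open>h = 0\<close> is read
  at points of the Legendre submanifold, where \<open>X0\<close> lives; the middle clause justifies
  this reading.\<close>

theorem proposition3p1:
  fixes C :: "'n::finite contact_pt set"
    and U :: "(real^'n) set"
    and \<psi> :: "real^'n \<Rightarrow> real"
    and F :: "real^'n \<Rightarrow> real^'n"
    and \<Gamma> :: "real \<Rightarrow> real"
  defines "X0 \<equiv> pushforward U (legendre_emb \<psi>) F"
    and "h \<equiv> ham \<psi> F \<Gamma>"
  assumes "open C" and "open U" and "C \<subseteq> U \<times> UNIV"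
    and "legendre_emb \<psi> ` U \<subseteq> C"
    and "smooth_on U \<psi>" and "strictly_convex_on U \<psi>"
    and "simply_connected (legendre_submanifold C \<psi>)"
    and "smooth_on U F" and "\<exists>x\<in>U. F x \<noteq> 0"
    and "smooth_on (Delta0 \<psi> ` C) \<Gamma>"
    and "\<Gamma> 0 = 0" and "\<forall>s\<in>Delta0 \<psi> ` C. s \<noteq> 0 \<longrightarrow> \<Gamma> s \<noteq> 0"
  shows
    "(\<forall>\<gamma> t. \<gamma> t \<in> U \<and> (\<gamma> has_vector_derivative F (\<gamma> t)) (at t) \<longrightarrow>
        (\<exists>pdot zdot.
           (\<forall>a. ((\<lambda>s. partial a \<psi> (\<gamma> s)) has_real_derivative pdot a) (at t)) \<and>
           ((\<lambda>s. \<psi> (\<gamma> s)) has_real_derivative zdot) (at t) \<and>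
           X0 (legendre_emb \<psi> (\<gamma> t)) =
             (\<Sum>a\<in>UNIV. F (\<gamma> t) $ a *\<^sub>R coord_x a) + (\<Sum>a\<in>UNIV. pdot a *\<^sub>R coord_p a)
               + zdot *\<^sub>R coord_z))
     \<and> legendre_submanifold C \<psi> \<subseteq> {y \<in> C. h y = 0}
     \<and> (\<forall>y\<in>legendre_submanifold C \<psi>. X0 y = contact_ham_vf h y)"
proof (intro conjI allI impI ballI subsetI)
  fix \<gamma> t
  assume "\<gamma> t \<in> U \<and> (\<gamma> has_vector_derivative F (\<gamma> t)) (at t)"
  then have \<gamma>: "\<gamma> t \<in> U" "(\<gamma> has_vector_derivative F (\<gamma> t)) (at t)" by auto
  \<comment> \<open>The witnesses are the components of the push-forward; the chain rule identifies
    them with the time derivatives along \<gamma>.\<close>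
  let ?pdot = "\<lambda>a. frechet_derivative (partial a \<psi>) (at (\<gamma> t)) (F (\<gamma> t))"
  let ?zdot = "frechet_derivative \<psi> (at (\<gamma> t)) (F (\<gamma> t))"
  have "X0 (legendre_emb \<psi> (\<gamma> t)) = (\<Sum>a\<in>UNIV. F (\<gamma> t) $ a *\<^sub>R coord_x a)
      + (\<Sum>a\<in>UNIV. ?pdot a *\<^sub>R coord_p a) + ?zdot *\<^sub>R coord_z"
    unfolding X0_def pushforward_legendre_emb[OF \<open>smooth_on U \<psi>\<close> \<gamma>(1)] sum_coords ..
  then show "\<exists>pdot zdot.
      (\<forall>a. ((\<lambda>s. partial a \<psi> (\<gamma> s)) has_real_derivative pdot a) (at t)) \<and>
      ((\<lambda>s. \<psi> (\<gamma> s)) has_real_derivative zdot) (at t) \<and>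
      X0 (legendre_emb \<psi> (\<gamma> t)) =
        (\<Sum>a\<in>UNIV. F (\<gamma> t) $ a *\<^sub>R coord_x a) + (\<Sum>a\<in>UNIV. pdot a *\<^sub>R coord_p a) + zdot *\<^sub>R coord_z"
    using has_real_derivative_along_curve[OF smooth_on_partial[OF \<open>smooth_on U \<psi>\<close>] \<gamma>]
      has_real_derivative_along_curve[OF \<open>smooth_on U \<psi>\<close> \<gamma>]
    by (intro exI[of _ ?pdot] exI[of _ ?zdot]) blast
next
  fix y
  assume y: "y \<in> legendre_submanifold C \<psi>"
  then show "y \<in> {y \<in> C. h y = 0}"
    using ham_legendre_emb[of \<Gamma> \<psi> F "fst y"] \<open>\<Gamma> 0 = 0\<close> legendre_submanifold_eq_emb[OF y]
    by (simp add: h_def legendre_submanifold_def)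
next
  fix y
  assume y: "y \<in> legendre_submanifold C \<psi>"
  then have "y \<in> C" "Delta0 \<psi> y = 0" by (auto simp: legendre_submanifold_def)
  \<comment> \<open>The point \<open>y\<close> itself shows that 0 lies in the set where \<Gamma> is
    smooth, so \<Gamma> has a derivative there.\<close>
  then have "0 \<in> Delta0 \<psi> ` C" by force
  then have "\<Gamma> differentiable (at 0)"
    using smooth_on_differentiable \<open>smooth_on (Delta0 \<psi> ` C) \<Gamma>\<close> by blast
  moreover have x: "fst y \<in> U"
    using \<open>y \<in> C\<close> \<open>C \<subseteq> U \<times> UNIV\<close> by auto
  ultimately have "contact_ham_vf h (legendre_emb \<psi> (fst y)) = X0 (legendre_emb \<psi> (fst y))"
    unfolding h_def X0_def pushforward_legendre_emb[OF \<open>smooth_on U \<psi>\<close> x]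
    using \<open>smooth_on U \<psi>\<close> \<open>smooth_on U F\<close> \<open>open U\<close> \<open>\<Gamma> 0 = 0\<close> by (intro contact_ham_vf_ham)
  then show "X0 y = contact_ham_vf h y"
    using legendre_submanifold_eq_emb[OF y] by simp
qed

end
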